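(* Let $f$ be $L_f$-smooth and strongly convex with parameter $\mu\ge 0$ on the closed convex (possibly unbounded) set $Q\subseteq\mathbb{R}^n$, let $\widetilde\nabla f$ satisfy $\|\widetilde\nabla f(x)-\nabla f(x)\|_2\le\delta$ for all $x\in Q$, and let $\|\tilde x_0-x^*\|_2\le R$ for some $R$. Let $\{x_k\},\{\tilde x_k\},\{z_k\}$ be generated by Algorithm STM$(L,\mu_\tau,x_{start})$ described in the context, and let $\tilde R_k$ be as in the context. (i) If $\mu\neq 0$, then for all $N\ge 0$: when the algorithm is run with $\tau=1$ (that is, $\mu_1=\mu$), $$f(x_N)-f(x^* )\le LR^2\exp\left(-\frac12\sqrt{\frac{\mu_1}{L}}\,N\right)+\left(1+\sqrt{\frac{L}{\mu_1}}\right)\delta_2+3\tilde R_N\delta_1,$$ and when the algorithm is run with $\tau=2$ (that is, $\mu_2=\mu/2$), $$f(x_N)-f(x^* )\le LR^2\exp\left(-\frac12\sqrt{\frac{\mu_2}{L}}\,N\right)+\left(1+\sqrt{\frac{L}{\mu_2}}\right)\delta_2+\left(1+\sqrt{\frac{L}{\mu_2}}\right)\delta_3.$$ (ii) If $\mu=0$ (so that $\mu_\tau=0$), then for all $N\ge 1$, $$f(x_N)-f(x^* )\le\frac{4LR^2}{N^2}+3\tilde R_N\delta_1+N\delta_2.$$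
   Context: Setting: $Q\subseteq\mathbb{R}^n$ is closed and convex, not necessarily bounded; the problem is $\min_{x\in Q}f(x)$, and $x^*$ is a solution (if not unique, the one closest to $x_{start}$). $f$ is $L_f$-smooth: $\|\nabla f(x)-\nabla f(y)\|_2\le L_f\|x-y\|_2$ for all $x,y\in Q$; and strongly convex with parameter $\mu\ge 0$: $f(x)+\langle\nabla f(x),y-x\rangle+\frac{\mu}{2}\|x-y\|_2^2\le f(y)$ for all $x,y\in Q$ ($\mu=0$ means convex). The inexact gradient satisfies $\|\widetilde\nabla f(x)-\nabla f(x)\|_2\le\delta$ for all $x\in Q$. Constants: $L=2L_f$, $\delta_1=\delta$, $\delta_2=\delta^2/L$, $\delta_3=\delta^2/\mu$ (if $\mu\ne0$); $\mu_1=\mu$, $\mu_2=\mu/2$ ($\tau=2$ is used only when $\mu\ne 0$). Algorithm STM$(L,\mu_\tau,x_{start})$, $x_{start}\in Q$: set $\tilde x_0=x_{start}$, $\alpha_0=A_0=1/L$, $\psi_0(x)=\frac12\|x-\tilde x_0\|_2^2+\alpha_0\left(f(\tilde x_0)+\langle\widetilde\nabla f(\tilde x_0),x-\tilde x_0\rangle+\frac{\mu_\tau}{2}\|x-\tilde x_0\|_2^2\right)$, $z_0=\arg\min_{y\in Q}\psi_0(y)$, $x_0=z_0$. For $k=1,2,\dots$: let $\alpha_k=\frac{1+\mu_\tau A_{k-1}}{2L}+\sqrt{\frac{(1+\mu_\tau A_{k-1})^2}{4L^2}+\frac{A_{k-1}(1+\mu_\tau A_{k-1})}{L}}$ (the positive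 root of $(1+\mu_\tau A_{k-1})(A_{k-1}+\alpha_k)=L\alpha_k^2$), $A_k=A_{k-1}+\alpha_k$, $\tilde x_k=\frac{A_{k-1}x_{k-1}+\alpha_kz_{k-1}}{A_k}$, $\psi_k(x)=\psi_{k-1}(x)+\alpha_k\left(f(\tilde x_k)+\langle\widetilde\nabla f(\tilde x_k),x-\tilde x_k\rangle+\frac{\mu_\tau}{2}\|x-\tilde x_k\|_2^2\right)$, $z_k=\arg\min_{y\in Q}\psi_k(y)$, $x_k=\frac{A_{k-1}x_{k-1}+\alpha_kz_k}{A_k}$. Notation: $\tilde R_k=\max_{0\le j\le k}\max\{\|z_j-x^*\|_2,\|x_j-x^*\|_2,\|\tilde x_j-x^*\|_2\}$. *)

theory Defs
  imports "HOL-Analysis.Analysis"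
begin

text \<open>
  Strong convexity of \<open>f\<close> on \<open>Q\<close> in its first-order form, where \<open>g\<close> is the gradient
  of \<open>f\<close>; \<open>\<mu> = 0\<close> is ordinary convexity.
\<close>

definition strongly_convex_on ::
    "real \<Rightarrow> 'a::real_inner set \<Rightarrow> ('a \<Rightarrow> real) \<Rightarrow> ('a \<Rightarrow> 'a) \<Rightarrow> bool" where
  "strongly_convex_on \<mu> Q f g \<longleftrightarrow>
     (\<forall>x\<in>Q. \<forall>y\<in>Q. f x + g x \<bullet> (y - x) + \<mu> / 2 * (norm (x - y))\<^sup>2 \<le> f y)"

text \<open>
  The state after iteration \<open>k\<close> holds, in this order,
  \<open>\<alpha>\<^sub>k\<close>, \<open>A\<^sub>k\<close>, \<open>\<psi>\<^sub>k\<close>, \<open>\<tilde>x\<^sub>k\<close> (the point where the inexact gradient is queried),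
  \<open>z\<^sub>k\<close> and \<open>x\<^sub>k\<close>.
\<close>

record 'a stm_state =
  stm_alpha :: real
  stm_A :: real
  stm_psi :: "'a \<Rightarrow> real"
  stm_xt :: 'a
  stm_z :: 'a
  stm_x :: 'a

text \<open>
  In the definitions below \<open>G\<close> is the inexact gradient and \<open>m\<close> stands for \<open>\<mu>\<^sub>\<tau>\<close>.
\<close>

definition stm_model :: "('a::real_inner \<Rightarrow> real) \<Rightarrow> ('a \<Rightarrow> 'a) \<Rightarrow> real \<Rightarrow> 'a \<Rightarrow> 'a \<Rightarrow> real" where
  "stm_model f G m u x = f u + G u \<bullet> (x - u) + m / 2 * (norm (x - u))\<^sup>2"

definition stm_init ::
    "'a::real_inner set \<Rightarrow> ('a \<Rightarrow> real) \<Rightarrow> ('a \<Rightarrow> 'a) \<Rightarrow> real \<Rightarrow> real \<Rightarrow> 'a \<Rightarrow> 'a stm_state" where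
  "stm_init Q f G L m xstart =
    (let \<psi> = (\<lambda>x. 1 / 2 * (norm (x - xstart))\<^sup>2 + 1 / L * stm_model f G m xstart x);
         z = arg_min \<psi> (\<lambda>y. y \<in> Q)
     in \<lparr>stm_alpha = 1 / L, stm_A = 1 / L, stm_psi = \<psi>, stm_xt = xstart, stm_z = z, stm_x = z\<rparr>)"

definition stm_next ::
    "'a::real_inner set \<Rightarrow> ('a \<Rightarrow> real) \<Rightarrow> ('a \<Rightarrow> 'a) \<Rightarrow> real \<Rightarrow> real \<Rightarrow> 'a stm_state \<Rightarrow> 'a stm_state" where
  "stm_next Q f G L m s =
    (let A = stm_A s;
         \<alpha> = (1 + m * A) / (2 * L) + sqrt ((1 + m * A)\<^sup>2 / (4 * L\<^sup>2) + A * (1 + m * A) / L);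
         A' = A + \<alpha>;
         u = (1 / A') *\<^sub>R (A *\<^sub>R stm_x s + \<alpha> *\<^sub>R stm_z s);
         \<psi> = (\<lambda>x. stm_psi s x + \<alpha> * stm_model f G m u x);
         z = arg_min \<psi> (\<lambda>y. y \<in> Q);
         x = (1 / A') *\<^sub>R (A *\<^sub>R stm_x s + \<alpha> *\<^sub>R z)
     in \<lparr>stm_alpha = \<alpha>, stm_A = A', stm_psi = \<psi>, stm_xt = u, stm_z = z, stm_x = x\<rparr>)"

primrec stm ::
    "'a::real_inner set \<Rightarrow> ('a \<Rightarrow> real) \<Rightarrow> ('a \<Rightarrow> 'a) \<Rightarrow> real \<Rightarrow> real \<Rightarrow> 'a \<Rightarrow> nat \<Rightarrow> 'a stm_state" where
  "stm Q f G L m xstart 0 = stm_init Q f G L m xstart"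
| "stm Q f G L m xstart (Suc k) = stm_next Q f G L m (stm Q f G L m xstart k)"

definition stm_radius :: "(nat \<Rightarrow> 'a::real_inner stm_state) \<Rightarrow> 'a \<Rightarrow> nat \<Rightarrow> real" where
  "stm_radius s xopt k =
     (MAX j\<in>{0..k}. max (norm (stm_z (s j) - xopt))
                     (max (norm (stm_x (s j) - xopt)) (norm (stm_xt (s j) - xopt))))"

end

theory Submission
  imports Defs
begin

text \<open>
  Induction on \<open>k\<close> bounds \<open>A\<^sub>k f(x\<^sub>k)\<close> by \<open>min \<psi>\<^sub>k\<close> plus accumulated errors: \<open>\<psi>\<^sub>k\<close> is a quadratic
  with leading coefficient \<open>(1 + \<mu>\<^sub>\<tau> A\<^sub>k) / 2\<close>, so it grows quadratically away from \<open>z\<^sub>k\<close>, and the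
  equation for \<open>\<alpha>\<^sub>k\<close> makes this growth cancel the quadratic term of the descent inequality.
  Since \<open>L = 2 L\<^sub>f\<close>, half of that term is left to absorb \<open>\<delta> \<parallel>x\<^sub>k - \<tilde>x\<^sub>k\<parallel>\<close> at the cost of \<open>\<delta>\<^sub>2\<close>.

  The gradient error at \<open>x\<^sub>k\<^sub>-\<^sub>1\<close> carries the large weight \<open>A\<^sub>k\<^sub>-\<^sub>1\<close>. For \<open>\<tau> = 1\<close> the identity
  \<open>A\<^sub>k\<^sub>-\<^sub>1 (x\<^sub>k\<^sub>-\<^sub>1 - \<tilde>x\<^sub>k) = \<alpha>\<^sub>k (\<tilde>x\<^sub>k - z\<^sub>k\<^sub>-\<^sub>1)\<close> reduces the weight to \<open>\<alpha>\<^sub>k\<close>; for \<open>\<tau> = 2\<close> the error is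
  absorbed by half of the strong convexity. The rates come from \<open>A\<^sub>k \<ge> (1 + sqrt (\<mu>\<^sub>\<tau> / L)) A\<^sub>k\<^sub>-\<^sub>1\<close>, and
  from \<open>A\<^sub>k \<ge> (k + 1)\<^sup>2 / (4 L)\<close> when \<open>\<mu> = 0\<close>.
\<close>

section \<open>Minimising a quadratic over a closed convex set\<close>

text \<open>Completing the square turns minimisation of \<open>\<psi>\<close> over \<open>Q\<close>
  into projection of one point onto \<open>Q\<close>; the growth bound is the obtuse angle property
  of that projection, scaled by \<open>q / 2\<close>.\<close>

lemma quadratic_arg_min:
  fixes Q :: "'a::euclidean_space set"
  assumes Q: "closed Q" "convex Q" "Q \<noteq> {}" and "q > 0"
    and \<psi>: "\<And>x. \<psi> x = c + b \<bullet> x + q / 2 * (norm x)\<^sup>2"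
  defines "z \<equiv> arg_min \<psi> (\<lambda>y. y \<in> Q)"
  shows quadratic_arg_min_in: "z \<in> Q"
    and quadratic_arg_min_growth: "y \<in> Q \<Longrightarrow> \<psi> z + q / 2 * (norm (y - z))\<^sup>2 \<le> \<psi> y"
proof -
  \<comment> \<open>The unconstrained minimiser of \<open>\<psi>\<close>.\<close>
  define p where "p = (- 1 / q) *\<^sub>R b"
  have sq: "\<psi> x = c - q / 2 * (norm p)\<^sup>2 + q / 2 * (norm (x - p))\<^sup>2" for x
  proof -
    have "b = - q *\<^sub>R p"
      using \<open>q > 0\<close> by (simp add: p_def)
    then show ?thesis
      unfolding \<psi> by (simp add: power2_norm_eq_inner inner_diff_left inner_diff_right inner_commute)
        (simp add: algebra_simps)
  qed
  have le_iff: "\<psi> x \<le> \<psi> y \<longleftrightarrow> dist p x \<le> dist p y" for x y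
    using \<open>q > 0\<close> by (simp add: sq dist_norm norm_minus_commute)
  \<comment> \<open>\<open>arg_min\<close> is a choice operator, so it says something about
    \<open>z\<close> only once some minimiser is known to exist.\<close>
  obtain w where "w \<in> Q" "\<And>y. y \<in> Q \<Longrightarrow> dist p w \<le> dist p y"
    by (rule distance_attains_inf[OF Q(1,3)]) auto
  then have "is_arg_min \<psi> (\<lambda>y. y \<in> Q) w"
    by (simp add: is_arg_min_linorder le_iff)
  then have "is_arg_min \<psi> (\<lambda>y. y \<in> Q) z"
    unfolding z_def arg_min_def by (rule someI)
  then have z: "z \<in> Q" "\<forall>y\<in>Q. dist p z \<le> dist p y"
    by (simp_all add: is_arg_min_linorder le_iff)
  show "z \<in> Q" by fact
  assume "y \<in> Q"
  then have "(p - z) \<bullet> (y - z) \<le> 0"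
    using any_closest_point_dot[OF Q(2,1) z(1)] z(2) by blast
  then have "(norm (z - p))\<^sup>2 + (norm (y - z))\<^sup>2 \<le> (norm (y - p))\<^sup>2"
    by (simp add: power2_norm_eq_inner inner_diff_left inner_diff_right inner_commute)
  then have "q / 2 * ((norm (z - p))\<^sup>2 + (norm (y - z))\<^sup>2) \<le> q / 2 * (norm (y - p))\<^sup>2"
    using \<open>q > 0\<close> by (intro mult_left_mono) auto
  then show "\<psi> z + q / 2 * (norm (y - z))\<^sup>2 \<le> \<psi> y"
    by (simp add: sq distrib_left)
qed

section \<open>Smoothness, strong convexity and an exponential estimate\<close>

text \<open>Mean value theorem on the segment from \<open>u\<close> to \<open>x\<close>, applied to
  \<open>f\<close> minus the linear and quadratic terms. Subtracting the quadratic first makes the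
  derivative nonpositive and yields the sharp constant \<open>C / 2\<close>.\<close>

lemma lipschitz_gradient_upper_bound:
  fixes Q :: "'a::real_inner set"
  assumes "convex Q"
    and der: "\<And>x. x \<in> Q \<Longrightarrow> (f has_derivative (\<lambda>h. g x \<bullet> h)) (at x within Q)"
    and lip: "C-lipschitz_on Q g"
    and "u \<in> Q" "x \<in> Q"
  shows "f x \<le> f u + g u \<bullet> (x - u) + C / 2 * (norm (x - u))\<^sup>2"
proof -
  define d where "d = x - u"
  define \<gamma> where "\<gamma> t = u + t *\<^sub>R d" for t
  have \<gamma>: "\<gamma> t \<in> Q" if "t \<in> {0..1}" for t
  proof -
    have "\<gamma> t = (1 - t) *\<^sub>R u + t *\<^sub>R x"
      by (simp add: \<gamma>_def d_def algebra_simps)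
    then show ?thesis
      using that assms(1,4,5) by (simp add: convexD_alt)
  qed
  define \<phi> where "\<phi> t = f (\<gamma> t) - t * (g u \<bullet> d) - C / 2 * t\<^sup>2 * (norm d)\<^sup>2" for t
  have "(\<phi> has_derivative (\<lambda>h. (g (\<gamma> t) \<bullet> d - g u \<bullet> d - C * t * (norm d)\<^sup>2) * h)) (at t within {0..1})"
    if t: "t \<in> {0..1}" for t
  proof -
    \<comment> \<open>The derivative of \<open>f\<close> is given only within \<open>Q\<close>, so
      the chain rule is applied within the image of the segment.\<close>
    have "(f has_derivative (\<lambda>h. g (\<gamma> t) \<bullet> h)) (at (\<gamma> t) within \<gamma> ` {0..1})"
      using der[OF \<gamma>[OF t]] by (rule has_derivative_subset) (use \<gamma> in auto)
    moreover have "(\<gamma> has_derivative (\<lambda>h. h *\<^sub>R d)) (at t within {0..1})"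
      unfolding \<gamma>_def by (auto intro!: derivative_eq_intros)
    ultimately have "(f \<circ> \<gamma> has_derivative ((\<lambda>h. g (\<gamma> t) \<bullet> h) \<circ> (\<lambda>h. h *\<^sub>R d))) (at t within {0..1})"
      by (intro diff_chain_within)
    then have "((\<lambda>t. f (\<gamma> t)) has_derivative (\<lambda>h. h * (g (\<gamma> t) \<bullet> d))) (at t within {0..1})"
      by (simp add: o_def)
    then show ?thesis
      unfolding \<phi>_def by (auto intro!: derivative_eq_intros simp: algebra_simps)
  qed
  from mvt_simple[OF zero_less_one this] obtain t where t: "t \<in> {0<..<1}"
    and eq: "\<phi> 1 - \<phi> 0 = g (\<gamma> t) \<bullet> d - g u \<bullet> d - C * t * (norm d)\<^sup>2"
    by auto
  have "g (\<gamma> t) \<bullet> d - g u \<bullet> d = (g (\<gamma> t) - g u) \<bullet> d"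
    by (simp add: inner_diff_left)
  also have "\<dots> \<le> norm (g (\<gamma> t) - g u) * norm d"
    by (rule norm_cauchy_schwarz)
  also have "\<dots> \<le> (C * norm (t *\<^sub>R d)) * norm d"
    using lipschitz_onD[OF lip \<gamma> \<open>u \<in> Q\<close>, of t] t
    by (intro mult_right_mono) (auto simp: dist_norm \<gamma>_def)
  finally have "\<phi> 1 \<le> \<phi> 0"
    using eq t by (simp add: power2_eq_square mult_ac)
  then show ?thesis
    by (simp add: \<phi>_def \<gamma>_def d_def)
qed

text \<open>Adding the strong convexity inequalities for \<open>(x, y)\<close> and
  \<open>(y, x)\<close> gives strong monotonicity of \<open>g\<close>, to be compared with the
  Lipschitz bound.\<close>

lemma strong_convexity_le_lipschitz:
  fixes Q :: "'a::real_inner set"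
  assumes sc: "strongly_convex_on \<mu> Q f g" and lip: "C-lipschitz_on Q g"
    and xy: "x \<in> Q" "y \<in> Q" "x \<noteq> y"
  shows "\<mu> \<le> C"
proof -
  have "f x + g x \<bullet> (y - x) + \<mu> / 2 * (norm (x - y))\<^sup>2 \<le> f y"
    "f y + g y \<bullet> (x - y) + \<mu> / 2 * (norm (y - x))\<^sup>2 \<le> f x"
    using sc xy by (auto simp: strongly_convex_on_def)
  then have "\<mu> * (norm (x - y))\<^sup>2 \<le> (g x - g y) \<bullet> (x - y)"
    by (simp add: norm_minus_commute algebra_simps)
  also have "\<dots> \<le> norm (g x - g y) * norm (x - y)"
    by (rule norm_cauchy_schwarz)
  also have "\<dots> \<le> (C * norm (x - y)) * norm (x - y)"
    using lipschitz_onD[OF lip xy(1,2)] by (intro mult_right_mono) (auto simp: dist_norm)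
  finally have "\<mu> * (norm (x - y))\<^sup>2 \<le> C * (norm (x - y))\<^sup>2"
    by (simp add: power2_eq_square mult_ac)
  then show ?thesis
    using xy(3) by simp
qed

text \<open>Turns a growth factor \<open>1 + q\<close> per step into an exponential rate; this is
  the source of the \<open>1 / 2\<close> in the exponent.\<close>

lemma exp_half_le:
  fixes q :: real
  assumes "0 \<le> q" "q \<le> 1"
  shows "exp (q / 2) \<le> 1 + q"
proof -
  have "exp (q / 2) \<le> 1 + q / 2 + (q / 2)\<^sup>2"
    using assms by (intro exp_bound) auto
  also have "(q / 2)\<^sup>2 \<le> q / 2"
    using assms mult_left_mono[of q 1 q] by (simp add: power2_eq_square)
  finally show ?thesis by simp
qed

section \<open>The recursion, for arbitrary \<open>f\<close> and \<open>G\<close>\<close>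

locale stm_run =
  fixes Q :: "'a::euclidean_space set" and f :: "'a \<Rightarrow> real" and G :: "'a \<Rightarrow> 'a"
    and L m :: real and xstart :: 'a
  assumes closed: "closed Q" and convex: "convex Q" and xstart: "xstart \<in> Q"
    and L_pos: "L > 0" and m_nonneg: "m \<ge> 0"
begin

abbreviation "state \<equiv> stm Q f G L m xstart"
abbreviation "\<alpha> k \<equiv> stm_alpha (state k)"
abbreviation "A k \<equiv> stm_A (state k)"
abbreviation "\<psi> k \<equiv> stm_psi (state k)"
abbreviation "u k \<equiv> stm_xt (state k)"
abbreviation "z k \<equiv> stm_z (state k)"
abbreviation "x k \<equiv> stm_x (state k)"

lemma state_0:
  "\<alpha> 0 = 1 / L" "A 0 = 1 / L" "u 0 = xstart" "x 0 = z 0"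
  "\<psi> 0 w = 1 / 2 * (norm (w - xstart))\<^sup>2 + 1 / L * stm_model f G m xstart w"
  "z 0 = arg_min (\<psi> 0) (\<lambda>y. y \<in> Q)"
  by (simp_all add: stm_init_def Let_def)

lemma state_Suc:
  "\<alpha> (Suc k) = (1 + m * A k) / (2 * L)
      + sqrt ((1 + m * A k)\<^sup>2 / (4 * L\<^sup>2) + A k * (1 + m * A k) / L)"
  "A (Suc k) = A k + \<alpha> (Suc k)"
  "u (Suc k) = (1 / A (Suc k)) *\<^sub>R (A k *\<^sub>R x k + \<alpha> (Suc k) *\<^sub>R z k)"
  "x (Suc k) = (1 / A (Suc k)) *\<^sub>R (A k *\<^sub>R x k + \<alpha> (Suc k) *\<^sub>R z (Suc k))"
  "\<psi> (Suc k) w = \<psi> k w + \<alpha> (Suc k) * stm_model f G m (u (Suc k)) w"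
  "z (Suc k) = arg_min (\<psi> (Suc k)) (\<lambda>y. y \<in> Q)"
  by (simp_all add: stm_next_def Let_def)

declare stm.simps [simp del]

lemma A_pos: "A k > 0"
proof (induction k)
  case 0
  show ?case using L_pos by (simp add: state_0)
next
  case (Suc k)
  have "\<alpha> (Suc k) \<ge> 0"
    unfolding state_Suc(1) using Suc m_nonneg L_pos by (intro add_nonneg_nonneg) auto
  then show ?case
    using Suc by (simp add: state_Suc(2))
qed

lemma \<alpha>_pos: "\<alpha> k > 0"
proof (cases k)
  case 0
  then show ?thesis using L_pos by (simp add: state_0)
next
  case (Suc j)
  have "(1 + m * A j) / (2 * L) > 0"
    using A_pos[of j] m_nonneg L_pos by (intro divide_pos_pos add_pos_nonneg) auto
  moreover have "sqrt ((1 + m * A j)\<^sup>2 / (4 * L\<^sup>2) + A j * (1 + m * A j) / L) \<ge> 0"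
    using A_pos[of j] m_nonneg L_pos by simp
  ultimately show ?thesis
    unfolding Suc state_Suc(1) by linarith
qed

text \<open>Squaring \<open>\<alpha> (Suc k) - b / (2 * L)\<close> removes the square root from the
  closed formula and leaves the quadratic equation that all later estimates use.\<close>

lemma \<alpha>_equation: "(1 + m * A k) * A (Suc k) = L * (\<alpha> (Suc k))\<^sup>2"
proof -
  define b where "b = 1 + m * A k"
  have "(\<alpha> (Suc k) - b / (2 * L))\<^sup>2 = b\<^sup>2 / (4 * L\<^sup>2) + A k * b / L"
    unfolding state_Suc(1) b_def using A_pos[of k] m_nonneg L_pos by simp
  then have "L * (L * (\<alpha> (Suc k))\<^sup>2) = L * (b * (A k + \<alpha> (Suc k)))"
    using L_pos by (simp add: power2_eq_square field_simps)
  then have "L * (\<alpha> (Suc k))\<^sup>2 = b * (A k + \<alpha> (Suc k))"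
    using L_pos by simp
  then show ?thesis
    by (simp add: state_Suc(2) b_def)
qed

lemma A_eq_sum: "A N = (\<Sum>k\<le>N. \<alpha> k)"
  by (induction N) (simp_all add: state_0 state_Suc(2))

lemma \<psi>_eq_sum:
  "\<psi> N w = 1 / 2 * (norm (w - xstart))\<^sup>2 + (\<Sum>k\<le>N. \<alpha> k * stm_model f G m (u k) w)"
  by (induction N) (simp_all add: state_0 state_Suc(5))

text \<open>The constant and linear coefficients stay anonymous because only the leading one enters
  the growth of \<open>\<psi> k\<close> around \<open>z k\<close>.\<close>

lemma \<psi>_quadratic: "\<exists>c b. \<forall>w. \<psi> k w = c + b \<bullet> w + (1 + m * A k) / 2 * (norm w)\<^sup>2"
proof -
  have model: "stm_model f G m v w =
      (f v - G v \<bullet> v + m / 2 * (norm v)\<^sup>2) + (G v - m *\<^sub>R v) \<bullet> w + m / 2 * (norm w)\<^sup>2" for v w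
    by (simp add: stm_model_def power2_norm_eq_inner inner_diff_left inner_diff_right
        field_simps inner_commute)
  show ?thesis
  proof (induction k)
    case 0
    show ?case
      unfolding state_0 model
      by (intro exI[of _ "1 / 2 * (norm xstart)\<^sup>2 + 1 / L * (f xstart - G xstart \<bullet> xstart + m / 2 * (norm xstart)\<^sup>2)"]
          exI[of _ "(1 / L) *\<^sub>R (G xstart - m *\<^sub>R xstart) - xstart"])
        (simp add: power2_norm_eq_inner inner_diff_left inner_diff_right
          algebra_simps inner_commute add_divide_distrib)
  next
    case (Suc k)
    then obtain c b where *: "\<psi> k w = c + b \<bullet> w + (1 + m * A k) / 2 * (norm w)\<^sup>2" for w
      by blast
    show ?case
      unfolding state_Suc(2,5) model *
      by (intro exI[of _ "c + \<alpha> (Suc k) * (f (u (Suc k)) - G (u (Suc k)) \<bullet> u (Suc k) + m / 2 * (norm (u (Suc k)))\<^sup>2)"]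
          exI[of _ "b + \<alpha> (Suc k) *\<^sub>R (G (u (Suc k)) - m *\<^sub>R u (Suc k))"])
        (simp add: inner_add_left algebra_simps add_divide_distrib)
  qed
qed

lemma one_mA_pos: "1 + m * A k > 0"
  using A_pos[of k] m_nonneg by (simp add: add_pos_nonneg)

lemma z_eq: "z k = arg_min (\<psi> k) (\<lambda>y. y \<in> Q)"
  by (cases k) (simp_all add: state_0(6) state_Suc(6))

lemma z_in: "z k \<in> Q"
  and \<psi>_growth: "y \<in> Q \<Longrightarrow> \<psi> k (z k) + (1 + m * A k) / 2 * (norm (y - z k))\<^sup>2 \<le> \<psi> k y"
proof -
  obtain c b where \<psi>: "\<And>w. \<psi> k w = c + b \<bullet> w + (1 + m * A k) / 2 * (norm w)\<^sup>2"
    using \<psi>_quadratic by blast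
  have "Q \<noteq> {}" using xstart by auto
  note quadratic_arg_min[OF closed convex this one_mA_pos \<psi>]
  then show "z k \<in> Q"
    and "y \<in> Q \<Longrightarrow> \<psi> k (z k) + (1 + m * A k) / 2 * (norm (y - z k))\<^sup>2 \<le> \<psi> k y"
    by (simp_all only: z_eq)
qed

lemma averaged_in:
  assumes "v \<in> Q" "w \<in> Q"
  shows "(1 / A (Suc k)) *\<^sub>R (A k *\<^sub>R v + \<alpha> (Suc k) *\<^sub>R w) \<in> Q"
proof -
  have "(A k / A (Suc k)) *\<^sub>R v + (\<alpha> (Suc k) / A (Suc k)) *\<^sub>R w \<in> Q"
    using A_pos[of k] \<alpha>_pos[of "Suc k"] assms
    by (intro convexD[OF convex]) (auto simp: state_Suc(2) simp flip: add_divide_distrib)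
  then show ?thesis
    by (simp add: scaleR_add_right)
qed

lemma x_in: "x k \<in> Q"
proof (induction k)
  case 0
  show ?case using z_in[of 0] by (simp add: state_0)
next
  case (Suc k)
  show ?case
    unfolding state_Suc(4) using Suc z_in by (rule averaged_in)
qed

lemma u_in: "u k \<in> Q"
proof (cases k)
  case 0
  then show ?thesis using xstart by (simp add: state_0)
next
  case (Suc j)
  show ?thesis
    unfolding Suc state_Suc(3) using x_in z_in by (rule averaged_in)
qed

lemma scaled_u: "A (Suc k) *\<^sub>R u (Suc k) = A k *\<^sub>R x k + \<alpha> (Suc k) *\<^sub>R z k"
  unfolding state_Suc(3) using A_pos[of "Suc k"] by simp

lemma scaled_x: "A (Suc k) *\<^sub>R x (Suc k) = A k *\<^sub>R x k + \<alpha> (Suc k) *\<^sub>R z (Suc k)"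
  unfolding state_Suc(4) using A_pos[of "Suc k"] by simp

lemma scaled_x_minus_u: "A k *\<^sub>R (x k - u (Suc k)) = \<alpha> (Suc k) *\<^sub>R (u (Suc k) - z k)"
  using scaled_u[of k] by (simp add: state_Suc(2) algebra_simps)

section \<open>The estimating sequence with abstract errors\<close>

text \<open>Both treatments of the gradient error share this induction. \<open>\<epsilon> k\<close>
  is the error of the descent inequality; \<open>\<eta> k\<close> is the error of the lower bound at
  \<open>x k\<close> with the weight \<open>A k\<close> already included, so that this weight can be
  reduced beforehand.\<close>

lemma estimating_sequence:
  assumes upper: "\<And>k. k \<le> N \<Longrightarrow>
      f (x k) \<le> f (u k) + G (u k) \<bullet> (x k - u k) + L / 2 * (norm (x k - u k))\<^sup>2 + \<epsilon> k"
    and lower: "\<And>k. k < N \<Longrightarrow>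
      A k * (f (u (Suc k)) + G (u (Suc k)) \<bullet> (x k - u (Suc k))) \<le> A k * f (x k) + \<eta> k"
  shows "A N * f (x N) \<le> \<psi> N (z N) + (\<Sum>k\<le>N. A k * \<epsilon> k) + (\<Sum>k<N. \<eta> k)"
  using assms
proof (induction N)
  case 0
  let ?M = "f xstart + G xstart \<bullet> (z 0 - xstart)"
  have "A 0 * f (x 0) \<le> A 0 * (?M + L / 2 * (norm (z 0 - xstart))\<^sup>2 + \<epsilon> 0)"
    using 0(1)[of 0] A_pos[of 0] by (intro mult_left_mono) (auto simp: state_0(3,4))
  \<comment> \<open>With \<open>A 0 = 1 / L\<close> the descent term becomes exactly the initial
    quadratic of \<open>\<psi> 0\<close>.\<close>
  also have "\<dots> = 1 / 2 * (norm (z 0 - xstart))\<^sup>2 + 1 / L * ?M + A 0 * \<epsilon> 0"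
    using L_pos by (simp add: state_0(2) field_simps)
  also have "\<dots> \<le> \<psi> 0 (z 0) + A 0 * \<epsilon> 0"
    using L_pos m_nonneg by (simp add: state_0(5) stm_model_def divide_right_mono)
  finally show ?case by simp
next
  case (Suc k)
  let ?v = "u (Suc k)" and ?E = "(\<Sum>j\<le>k. A j * \<epsilon> j) + (\<Sum>j<k. \<eta> j)"
  have IH: "A k * f (x k) \<le> \<psi> k (z k) + ?E"
    using Suc.IH Suc.prems by (simp add: add.assoc)
  \<comment> \<open>\<open>x (Suc k)\<close> and \<open>u (Suc k)\<close> are the same average
    except that \<open>z (Suc k)\<close> replaces \<open>z k\<close>.\<close>
  have step: "A (Suc k) *\<^sub>R (x (Suc k) - ?v) = \<alpha> (Suc k) *\<^sub>R (z (Suc k) - z k)"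
    using scaled_x[of k] scaled_u[of k] by (simp add: algebra_simps)
  \<comment> \<open>The \<open>A k\<close> part will meet the induction hypothesis, the
    \<open>\<alpha> (Suc k)\<close> part the model added to \<open>\<psi> (Suc k)\<close>.\<close>
  have split: "A (Suc k) *\<^sub>R (x (Suc k) - ?v) = A k *\<^sub>R (x k - ?v) + \<alpha> (Suc k) *\<^sub>R (z (Suc k) - ?v)"
    using scaled_x[of k] by (simp add: state_Suc(2) algebra_simps)
  have lin: "A (Suc k) * (G ?v \<bullet> (x (Suc k) - ?v))
      = A k * (G ?v \<bullet> (x k - ?v)) + \<alpha> (Suc k) * (G ?v \<bullet> (z (Suc k) - ?v))"
    using arg_cong[OF split, of "(\<bullet>) (G ?v)"] by (simp add: inner_add_right)
  \<comment> \<open>The extra factor \<open>A (Suc k)\<close> makes \<open>step\<close> and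
    \<open>\<alpha>_equation\<close> applicable and is cancelled afterwards.\<close>
  have "A (Suc k) * (A (Suc k) * (L * (norm (x (Suc k) - ?v))\<^sup>2))
      = L * (norm (A (Suc k) *\<^sub>R (x (Suc k) - ?v)))\<^sup>2"
    by (simp add: power2_eq_square mult_ac)
  also have "\<dots> = L * (\<alpha> (Suc k))\<^sup>2 * (norm (z (Suc k) - z k))\<^sup>2"
    unfolding step by (simp add: power_mult_distrib)
  also have "\<dots> = A (Suc k) * ((1 + m * A k) * (norm (z (Suc k) - z k))\<^sup>2)"
    unfolding \<alpha>_equation[symmetric] by simp
  finally have quad: "A (Suc k) * (L * (norm (x (Suc k) - ?v))\<^sup>2)
      = (1 + m * A k) * (norm (z (Suc k) - z k))\<^sup>2"
    using A_pos[of "Suc k"] by simp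
  have "A (Suc k) * f (x (Suc k)) \<le> A (Suc k) * (f ?v + G ?v \<bullet> (x (Suc k) - ?v)
      + L / 2 * (norm (x (Suc k) - ?v))\<^sup>2 + \<epsilon> (Suc k))"
    using Suc.prems(1)[of "Suc k"] A_pos[of "Suc k"] by (intro mult_left_mono) auto
  also have "\<dots> = A k * (f ?v + G ?v \<bullet> (x k - ?v))
      + \<alpha> (Suc k) * (f ?v + G ?v \<bullet> (z (Suc k) - ?v))
      + (1 + m * A k) / 2 * (norm (z (Suc k) - z k))\<^sup>2 + A (Suc k) * \<epsilon> (Suc k)"
    using lin quad by (simp add: distrib_left) (simp add: state_Suc(2) distrib_right)
  also have "\<dots> \<le> (\<psi> k (z k) + ?E + \<eta> k)
      + \<alpha> (Suc k) * stm_model f G m ?v (z (Suc k))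
      + (1 + m * A k) / 2 * (norm (z (Suc k) - z k))\<^sup>2 + A (Suc k) * \<epsilon> (Suc k)"
    using Suc.prems(2)[of k] IH \<alpha>_pos[of "Suc k"] m_nonneg
    by (intro add_mono mult_left_mono order_refl) (auto simp: stm_model_def)
  also have "\<dots> \<le> \<psi> (Suc k) (z (Suc k)) + ?E + \<eta> k + A (Suc k) * \<epsilon> (Suc k)"
    using \<psi>_growth[OF z_in, of k "Suc k"] by (simp add: state_Suc(5))
  finally show ?case by simp
qed

text \<open>The minimum of \<open>\<psi> N\<close> is at most its value at \<open>xopt\<close>.
  There the model error \<open>\<zeta>\<close> is weighted by the \<open>\<alpha> k\<close>, which
  add up to \<open>A N\<close>.\<close>

lemma suboptimality_bound:
  assumes "xopt \<in> Q" and "norm (xstart - xopt) \<le> R"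
    and upper: "\<And>k. k \<le> N \<Longrightarrow>
      f (x k) \<le> f (u k) + G (u k) \<bullet> (x k - u k) + L / 2 * (norm (x k - u k))\<^sup>2 + \<epsilon> k"
    and lower: "\<And>k. k < N \<Longrightarrow>
      A k * (f (u (Suc k)) + G (u (Suc k)) \<bullet> (x k - u (Suc k))) \<le> A k * f (x k) + \<eta> k"
    and opt: "\<And>k. k \<le> N \<Longrightarrow> stm_model f G m (u k) xopt \<le> f xopt + \<zeta>"
  shows "A N * (f (x N) - f xopt)
    \<le> R\<^sup>2 / 2 + (\<Sum>k\<le>N. A k * \<epsilon> k) + (\<Sum>k<N. \<eta> k) + A N * \<zeta>"
proof -
  have "\<psi> N (z N) \<le> \<psi> N xopt"
    using \<psi>_growth[OF \<open>xopt \<in> Q\<close>, of N] one_mA_pos[of N]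
    by (smt (verit) divide_nonneg_nonneg mult_nonneg_nonneg zero_le_power2)
  also have "\<dots> \<le> 1 / 2 * R\<^sup>2 + (\<Sum>k\<le>N. \<alpha> k * (f xopt + \<zeta>))"
    unfolding \<psi>_eq_sum using assms(2) opt less_imp_le[OF \<alpha>_pos]
    by (intro add_mono mult_left_mono power_mono sum_mono) (auto simp: norm_minus_commute)
  also have "\<dots> = R\<^sup>2 / 2 + A N * f xopt + A N * \<zeta>"
    by (simp add: A_eq_sum sum_distrib_right distrib_left sum.distrib)
  finally have "\<psi> N (z N) \<le> R\<^sup>2 / 2 + A N * f xopt + A N * \<zeta>" .
  moreover have "A N * f (x N) \<le> \<psi> N (z N) + (\<Sum>k\<le>N. A k * \<epsilon> k) + (\<Sum>k<N. \<eta> k)"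
    using upper lower by (rule estimating_sequence)
  ultimately show ?thesis
    by (simp add: right_diff_distrib)
qed

section \<open>Growth of the weights \<open>A k\<close>\<close>

lemma A_mono: "i \<le> j \<Longrightarrow> A i \<le> A j"
  by (rule lift_Suc_mono_le[of A]) (simp_all add: state_Suc(2) less_imp_le[OF \<alpha>_pos])

text \<open>Dropping the 1 in \<open>1 + m * A k\<close> from \<open>\<alpha>_equation\<close>
  leaves \<open>m * (A k)\<^sup>2 \<le> L * (\<alpha> (Suc k))\<^sup>2\<close>.\<close>

lemma A_growth: "(1 + sqrt (m / L)) * A k \<le> A (Suc k)"
proof -
  have "m * (A k)\<^sup>2 \<le> m * A k * A (Suc k)"
    using A_mono[of k "Suc k"] A_pos[of k] m_nonneg
    by (simp add: power2_eq_square mult.assoc mult_left_mono)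
  also have "\<dots> \<le> L * (\<alpha> (Suc k))\<^sup>2"
    using \<alpha>_equation[of k] A_pos[of "Suc k"] by (simp add: distrib_right)
  finally have "m / L * (A k)\<^sup>2 \<le> (\<alpha> (Suc k))\<^sup>2"
    using L_pos by (simp add: field_simps)
  then have "sqrt (m / L * (A k)\<^sup>2) \<le> sqrt ((\<alpha> (Suc k))\<^sup>2)"
    by (rule real_sqrt_le_mono)
  then have "sqrt (m / L) * A k \<le> \<alpha> (Suc k)"
    using A_pos[of k] \<alpha>_pos[of "Suc k"] by (simp only: real_sqrt_mult) simp
  then show ?thesis
    by (simp add: state_Suc(2) distrib_right)
qed

lemma A_exp_lower_bound:
  assumes "m \<le> L"
  shows "exp (1 / 2 * sqrt (m / L) * real N) / L \<le> A N"
proof (induction N)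
  case 0
  show ?case by (simp add: state_0)
next
  case (Suc N)
  let ?q = "sqrt (m / L)"
  have "?q \<le> 1" "?q \<ge> 0"
    using assms m_nonneg L_pos by auto
  then have e: "exp (?q / 2) \<le> 1 + ?q"
    by (intro exp_half_le)
  have "exp (1 / 2 * ?q * real (Suc N)) / L = exp (?q / 2) * (exp (1 / 2 * ?q * real N) / L)"
    by (simp add: algebra_simps add_divide_distrib exp_add)
  also have "\<dots> \<le> (1 + ?q) * A N"
    using e Suc \<open>?q \<ge> 0\<close> L_pos by (intro mult_mono) auto
  also have "\<dots> \<le> A (Suc N)"
    by (rule A_growth)
  finally show ?case .
qed

text \<open>Geometric growth lets the last weight dominate the sum: \<open>1 + sqrt (L / m)\<close>
  is \<open>sqrt (L / m)\<close> times the growth factor \<open>1 + sqrt (m / L)\<close>.\<close>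

lemma sum_A_le:
  assumes "m > 0"
  shows "(\<Sum>k\<le>N. A k) \<le> (1 + sqrt (L / m)) * A N"
proof (induction N)
  case 0
  show ?case using A_pos[of 0] L_pos assms by (simp add: distrib_right)
next
  case (Suc N)
  have "sqrt (L / m) * sqrt (m / L) = 1"
    using L_pos assms by (simp flip: real_sqrt_mult)
  then have "(1 + sqrt (L / m)) * A N = sqrt (L / m) * ((1 + sqrt (m / L)) * A N)"
    by (simp add: algebra_simps)
  also have "\<dots> \<le> sqrt (L / m) * A (Suc N)"
    using A_growth L_pos assms by (intro mult_left_mono) auto
  finally show ?case
    using Suc by (simp add: distrib_right)
qed

text \<open>With \<open>s = (N + 1) / 2\<close> and \<open>a = \<alpha> (Suc N) * L\<close>, the
  induction hypothesis and \<open>\<alpha>_equation\<close> give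
  \<open>s\<^sup>2 + a \<le> A (Suc N) * L \<le> a\<^sup>2\<close>. Hence
  \<open>a \<ge> s + 1 / 2\<close>, and the left inequality yields
  \<open>(s + 1 / 2)\<^sup>2\<close>.\<close>

lemma A_square_lower_bound: "(real N + 1)\<^sup>2 / (4 * L) \<le> A N"
proof (induction N)
  case 0
  show ?case using L_pos by (simp add: state_0 field_simps)
next
  case (Suc N)
  define a where "a = \<alpha> (Suc N) * L"
  have "a > 0"
    using \<alpha>_pos[of "Suc N"] L_pos by (simp add: a_def)
  have "1 * A (Suc N) \<le> (1 + m * A N) * A (Suc N)"
    using m_nonneg A_pos[of N] A_pos[of "Suc N"] by (intro mult_right_mono) auto
  then have AL: "A (Suc N) * L \<le> a\<^sup>2"
    using \<alpha>_equation[of N] L_pos by (simp add: a_def power2_eq_square mult_ac)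
  have "(real N + 1)\<^sup>2 / 4 + a \<le> A (Suc N) * L"
    using Suc L_pos by (simp add: state_Suc(2) a_def distrib_right field_simps)
  define s where "s = (real N + 1) / 2"
  have step: "s\<^sup>2 + a \<le> A (Suc N) * L"
    using \<open>(real N + 1)\<^sup>2 / 4 + a \<le> _\<close> by (simp add: s_def power_divide)
  then have "s\<^sup>2 + 1 / 4 \<le> (a - 1 / 2)\<^sup>2"
    using AL by (simp add: power2_eq_square algebra_simps)
  then have "s\<^sup>2 \<le> (a - 1 / 2)\<^sup>2"
    by linarith
  \<comment> \<open>Selects the sign of \<open>a - 1 / 2\<close> before the square root is taken: a
    smaller \<open>a\<close> would have \<open>a\<^sup>2 \<le> a\<close>, against
    \<open>s\<^sup>2 + a \<le> a\<^sup>2\<close>.\<close>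
  moreover have "a \<ge> 1 / 2"
  proof (rule ccontr)
    assume "\<not> a \<ge> 1 / 2"
    with \<open>a > 0\<close> have "a * a \<le> a * 1"
      by (intro mult_left_mono) auto
    moreover have "s\<^sup>2 > 0"
      by (simp add: s_def)
    ultimately show False
      using step AL by (simp add: power2_eq_square)
  qed
  ultimately have "s \<le> a - 1 / 2"
    by (intro power2_le_imp_le[of s]) auto
  then have "(s + 1 / 2)\<^sup>2 \<le> A (Suc N) * L"
    using step by (simp add: power2_eq_square algebra_simps)
  then show ?case
    using L_pos by (simp add: s_def field_simps)
qed

end

section \<open>Inequalities for the inexact gradient\<close>

text \<open>The parameter \<open>m\<close> of the method and the modulus \<open>\<mu>\<close> of
  \<open>f\<close> are kept apart, so that one setting covers both values of \<tau> and the convex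
  case.\<close>

locale stm_inexact = stm_run +
  fixes grad :: "'a \<Rightarrow> 'a" and Lf \<mu> \<delta> R :: real and xopt :: 'a
  assumes deriv: "\<And>x. x \<in> Q \<Longrightarrow> (f has_derivative (\<lambda>h. grad x \<bullet> h)) (at x within Q)"
    and lipschitz: "Lf-lipschitz_on Q grad" and L_eq: "L = 2 * Lf"
    and strongly_convex: "strongly_convex_on \<mu> Q f grad" and m_le: "m \<le> \<mu>"
    and inexact: "\<And>x. x \<in> Q \<Longrightarrow> norm (G x - grad x) \<le> \<delta>"
    and xopt_in: "xopt \<in> Q" and start: "norm (xstart - xopt) \<le> R"
begin

abbreviation "radius \<equiv> stm_radius state xopt"

lemma \<delta>_nonneg: "\<delta> \<ge> 0"
  using inexact[OF xstart] norm_ge_zero order_trans by blast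

lemma gradient_error:
  assumes "v \<in> Q"
  shows "\<bar>G v \<bullet> d - grad v \<bullet> d\<bar> \<le> \<delta> * norm d"
proof -
  have "\<bar>(G v - grad v) \<bullet> d\<bar> \<le> norm (G v - grad v) * norm d"
    by (rule Cauchy_Schwarz_ineq2)
  also have "\<dots> \<le> \<delta> * norm d"
    using inexact[OF assms] by (rule mult_right_mono) simp
  finally show ?thesis
    by (simp add: inner_diff_left)
qed

lemma inexact_upper_linear:
  assumes "v \<in> Q" "w \<in> Q"
  shows "f w \<le> f v + G v \<bullet> (w - v) + L / 4 * (norm (w - v))\<^sup>2 + \<delta> * norm (w - v)"
  using lipschitz_gradient_upper_bound[OF convex deriv lipschitz assms]
    gradient_error[OF assms(1), of "w - v"] by (simp add: L_eq)

lemma inexact_upper: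
  assumes "v \<in> Q" "w \<in> Q"
  shows "f w \<le> f v + G v \<bullet> (w - v) + L / 2 * (norm (w - v))\<^sup>2 + \<delta>\<^sup>2 / L"
proof -
  \<comment> \<open>Young's inequality, with the weight that exactly uses up the spare
    \<open>L / 4\<close>.\<close>
  have "\<delta> * r \<le> L / 4 * r\<^sup>2 + \<delta>\<^sup>2 / L" for r
    using zero_le_power2[of "L * r / 2 - \<delta>"] L_pos by (simp add: power2_eq_square field_simps)
  from this[of "norm (w - v)"] show ?thesis
    using inexact_upper_linear[OF assms] by linarith
qed

lemma exact_lower:
  assumes "v \<in> Q" "w \<in> Q"
  shows "f v + grad v \<bullet> (w - v) + \<mu> / 2 * (norm (w - v))\<^sup>2 \<le> f w"
  using strongly_convex assms by (simp add: strongly_convex_on_def norm_minus_commute)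

text \<open>The error stays a linear expression in \<open>w - v\<close> instead of a norm, so that a
  scaled displacement can be rewritten before Cauchy-Schwarz is applied.\<close>

lemma inexact_lower_linear:
  assumes "v \<in> Q" "w \<in> Q"
  shows "stm_model f G m v w \<le> f w + (G v \<bullet> (w - v) - grad v \<bullet> (w - v))"
  using exact_lower[OF assms] mult_right_mono[OF m_le, of "(norm (w - v))\<^sup>2"]
  by (simp add: stm_model_def)

text \<open>With \<open>m \<le> \<mu> / 2\<close> at least \<open>\<mu> / 4\<close> of the quadratic
  term is spare, just what Young's inequality needs to absorb the gradient error.\<close>

lemma inexact_lower:
  assumes "v \<in> Q" "w \<in> Q" and "\<mu> > 0" "m \<le> \<mu> / 2"
  shows "stm_model f G m v w \<le> f w + \<delta>\<^sup>2 / \<mu>"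
proof -
  have "\<delta> * r \<le> \<mu> / 4 * r\<^sup>2 + \<delta>\<^sup>2 / \<mu>" for r
    using zero_le_power2[of "\<mu> * r / 2 - \<delta>"] \<open>\<mu> > 0\<close>
    by (simp add: power2_eq_square field_simps)
  from this[of "norm (w - v)"] show ?thesis
    using exact_lower[OF assms(1,2)] gradient_error[OF assms(1), of "w - v"]
      mult_right_mono[OF assms(4), of "(norm (w - v))\<^sup>2"]
    by (simp add: stm_model_def)
qed

section \<open>Accumulated errors: bounded by the radius or absorbed by strong convexity\<close>

lemma radius_ge:
  assumes "k \<le> N"
  shows "norm (z k - xopt) \<le> radius N" "norm (x k - xopt) \<le> radius N"
    "norm (u k - xopt) \<le> radius N"
proof -
  have "max (norm (z k - xopt)) (max (norm (x k - xopt)) (norm (u k - xopt))) \<le> radius N"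
    unfolding stm_radius_def using assms by (intro Max_ge) auto
  then show "norm (z k - xopt) \<le> radius N" "norm (x k - xopt) \<le> radius N"
    "norm (u k - xopt) \<le> radius N"
    by auto
qed

lemma radius_nonneg: "radius N \<ge> 0"
  using radius_ge(1)[of N N] norm_ge_zero order_trans by blast

lemma dist_le_twice_radius:
  assumes "norm (a - xopt) \<le> radius N" "norm (b - xopt) \<le> radius N"
  shows "norm (a - b) \<le> 2 * radius N"
  using norm_triangle_ineq4[of "a - xopt" "b - xopt"] assms by simp

text \<open>The factor 3 is \<open>2 + 1\<close>. Distances between two iterates cost twice the
  radius, with weights \<open>A 0\<close> and \<open>\<alpha> (Suc k)\<close> adding up to
  \<open>A N\<close>; the model error at \<open>xopt\<close> costs the radius once, also with total
  weight \<open>A N\<close>.\<close>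

lemma radius_bound:
  "A N * (f (x N) - f xopt)
    \<le> R\<^sup>2 / 2 + \<delta>\<^sup>2 / L * (\<Sum>k<N. A (Suc k)) + A N * (3 * radius N * \<delta>)"
proof -
  define \<rho> where "\<rho> = radius N"
  \<comment> \<open>Charging the error of step 0 to the radius keeps \<open>A\<^sub>0\<close> out of the \<open>\<delta>\<^sup>2 / L\<close> sum;
    otherwise that sum would exceed \<open>N A\<^sub>N\<close> for \<open>N = 1\<close>, which \<open>rate_sublinear\<close> cannot afford.\<close>
  define \<epsilon> where "\<epsilon> k = (if k = 0 then 2 * \<rho> * \<delta> else \<delta>\<^sup>2 / L)" for k :: nat
  define \<eta> where "\<eta> k = \<alpha> (Suc k) * (2 * \<rho> * \<delta>)" for k
  have upper: "f (x k) \<le> f (u k) + G (u k) \<bullet> (x k - u k) + L / 2 * (norm (x k - u k))\<^sup>2 + \<epsilon> k"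
    if "k \<le> N" for k
  proof (cases "k = 0")
    case True
    have "\<delta> * norm (x k - u k) \<le> \<delta> * (2 * \<rho>)"
      unfolding \<rho>_def using that \<delta>_nonneg
      by (intro mult_left_mono dist_le_twice_radius radius_ge)
    moreover have "L / 4 * (norm (x k - u k))\<^sup>2 \<le> L / 2 * (norm (x k - u k))\<^sup>2"
      using L_pos by (intro mult_right_mono) auto
    ultimately show ?thesis
      using inexact_upper_linear[OF u_in x_in, of k k] True by (simp add: \<epsilon>_def mult_ac)
  next
    case False
    then show ?thesis
      using inexact_upper[OF u_in x_in, of k k] by (simp add: \<epsilon>_def)
  qed
  have lower: "A k * (f (u (Suc k)) + G (u (Suc k)) \<bullet> (x k - u (Suc k))) \<le> A k * f (x k) + \<eta> k"
    if "k < N" for k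
  proof -
    let ?v = "u (Suc k)"
    let ?e = "\<lambda>d. G ?v \<bullet> d - grad ?v \<bullet> d"
    have "f ?v + G ?v \<bullet> (x k - ?v) \<le> f (x k) + ?e (x k - ?v)"
      using inexact_lower_linear[OF u_in x_in, of "Suc k" k]
        mult_nonneg_nonneg[OF m_nonneg, of "(norm (x k - ?v))\<^sup>2"]
      unfolding stm_model_def by simp
    then have "A k * (f ?v + G ?v \<bullet> (x k - ?v)) \<le> A k * (f (x k) + ?e (x k - ?v))"
      using A_pos[of k] by (intro mult_left_mono) auto
    also have "\<dots> = A k * f (x k) + ?e (A k *\<^sub>R (x k - ?v))"
      by (simp add: algebra_simps)
    also have "?e (A k *\<^sub>R (x k - ?v)) = \<alpha> (Suc k) * ?e (?v - z k)"
      unfolding scaled_x_minus_u by (simp add: right_diff_distrib)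
    also have "\<dots> \<le> \<alpha> (Suc k) * (\<delta> * norm (?v - z k))"
      using gradient_error[OF u_in, of "Suc k" "?v - z k"] \<alpha>_pos[of "Suc k"]
      by (intro mult_left_mono) auto
    also have "\<dots> \<le> \<alpha> (Suc k) * (\<delta> * (2 * \<rho>))"
      unfolding \<rho>_def using that \<delta>_nonneg less_imp_le[OF \<alpha>_pos]
      by (intro mult_left_mono dist_le_twice_radius radius_ge) auto
    finally show ?thesis
      by (simp add: \<eta>_def mult_ac)
  qed
  have opt: "stm_model f G m (u k) xopt \<le> f xopt + \<rho> * \<delta>" if "k \<le> N" for k
  proof -
    have "\<delta> * norm (xopt - u k) \<le> \<delta> * \<rho>"
      using radius_ge(3)[OF that] \<delta>_nonneg by (simp add: \<rho>_def norm_minus_commute mult_left_mono)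
    then show ?thesis
      using inexact_lower_linear[OF u_in xopt_in, of k] gradient_error[OF u_in, of k "xopt - u k"]
      by (simp add: mult_ac)
  qed
  have "(\<Sum>k\<le>N. A k * \<epsilon> k) = A 0 * (2 * \<rho> * \<delta>) + \<delta>\<^sup>2 / L * (\<Sum>k<N. A (Suc k))"
    unfolding sum.atMost_shift by (simp add: \<epsilon>_def sum_distrib_left mult_ac)
  moreover have "A 0 * (2 * \<rho> * \<delta>) + (\<Sum>k<N. \<eta> k) = A N * (2 * \<rho> * \<delta>)"
    unfolding A_eq_sum[of N] sum.atMost_shift
    by (simp add: \<eta>_def state_0 distrib_right sum_distrib_right)
  moreover have "A N * (f (x N) - f xopt)
      \<le> R\<^sup>2 / 2 + (\<Sum>k\<le>N. A k * \<epsilon> k) + (\<Sum>k<N. \<eta> k) + A N * (\<rho> * \<delta>)"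
    using xopt_in start upper lower opt by (rule suboptimality_bound)
  moreover have "A N * (3 * radius N * \<delta>) = A N * (2 * \<rho> * \<delta>) + A N * (\<rho> * \<delta>)"
    by (simp add: \<rho>_def)
  ultimately show ?thesis
    by linarith
qed

lemma young_bound:
  assumes "\<mu> > 0" "m \<le> \<mu> / 2"
  shows "A N * (f (x N) - f xopt)
    \<le> R\<^sup>2 / 2 + (\<delta>\<^sup>2 / L + \<delta>\<^sup>2 / \<mu>) * (\<Sum>k\<le>N. A k)"
proof -
  have lower: "A k * (f (u (Suc k)) + G (u (Suc k)) \<bullet> (x k - u (Suc k)))
      \<le> A k * f (x k) + A k * (\<delta>\<^sup>2 / \<mu>)" for k
  proof -
    have "f (u (Suc k)) + G (u (Suc k)) \<bullet> (x k - u (Suc k)) \<le> f (x k) + \<delta>\<^sup>2 / \<mu>"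
      using inexact_lower[OF u_in x_in assms, of "Suc k" k]
        mult_nonneg_nonneg[OF m_nonneg, of "(norm (x k - u (Suc k)))\<^sup>2"]
      unfolding stm_model_def by simp
    then show ?thesis
      unfolding distrib_left[symmetric] using A_pos[of k] by (intro mult_left_mono) auto
  qed
  have "A N * (f (x N) - f xopt) \<le> R\<^sup>2 / 2 + (\<Sum>k\<le>N. A k * (\<delta>\<^sup>2 / L))
      + (\<Sum>k<N. A k * (\<delta>\<^sup>2 / \<mu>)) + A N * (\<delta>\<^sup>2 / \<mu>)"
    by (intro suboptimality_bound[OF xopt_in start] inexact_upper inexact_lower lower assms
        u_in x_in xopt_in)
  \<comment> \<open>The error at \<open>xopt\<close>, of weight \<open>A N\<close>, supplies the
    missing last term of the sum over \<open>k < N\<close>.\<close>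
  also have "\<dots> = R\<^sup>2 / 2 + (\<delta>\<^sup>2 / L + \<delta>\<^sup>2 / \<mu>) * (\<Sum>k\<le>N. A k)"
    by (simp add: algebra_simps add_divide_distrib flip: lessThan_Suc_atMost sum_divide_distrib sum_distrib_left sum_distrib_right)
  finally show ?thesis .
qed

section \<open>Convergence rates\<close>

text \<open>\<open>K\<close> collects errors weighted by \<open>A k\<close>, which cost the factor
  from \<open>sum_A_le\<close>; \<open>c\<close> collects errors of total weight \<open>A N\<close>,
  which survive the division unchanged.\<close>

lemma linear_rate:
  assumes "m > 0" "K \<ge> 0" "c \<ge> 0"
    and bound: "A N * (f (x N) - f xopt) \<le> R\<^sup>2 / 2 + K * (\<Sum>k\<le>N. A k) + A N * c"
  shows "f (x N) - f xopt
    \<le> L * R\<^sup>2 * exp (- (1 / 2) * sqrt (m / L) * real N) + (1 + sqrt (L / m)) * K + c"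
proof (cases "m \<le> L")
  case True
  let ?e = "exp (1 / 2 * sqrt (m / L) * real N)"
  have "f (x N) - f xopt \<le> (R\<^sup>2 / 2 + K * (\<Sum>k\<le>N. A k) + A N * c) / A N"
    using bound A_pos[of N] by (simp add: pos_le_divide_eq mult_ac)
  also have "\<dots> = R\<^sup>2 / 2 / A N + K * ((\<Sum>k\<le>N. A k) / A N) + c"
    using A_pos[of N] by (simp add: add_divide_distrib)
  \<comment> \<open>The factor \<open>1 / 2\<close> of \<open>R\<^sup>2\<close> is given away
    here.\<close>
  also have "\<dots> \<le> R\<^sup>2 / (?e / L) + K * (1 + sqrt (L / m)) + c"
    using A_exp_lower_bound[OF True, of N] sum_A_le[OF \<open>m > 0\<close>, of N] A_pos[of N] L_pos \<open>K \<ge> 0\<close>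
    by (intro add_mono frac_le mult_left_mono) (auto simp: pos_divide_le_eq)
  also have "R\<^sup>2 / (?e / L) = L * R\<^sup>2 * exp (- (1 / 2) * sqrt (m / L) * real N)"
    by (simp add: exp_minus field_simps)
  finally show ?thesis
    by (simp add: mult_ac)
next
  \<comment> \<open>\<open>\<mu> \<le> Lf\<close> holds as soon as \<open>Q\<close> has two points, so this case forces \<open>Q = {xopt}\<close>.\<close>
  case False
  then have "x N = xopt"
    using strong_convexity_le_lipschitz[OF strongly_convex lipschitz x_in xopt_in, of N] m_le L_eq L_pos
    by force
  then show ?thesis
    using assms(1-3) L_pos by simp
qed

lemma rate_radius:
  assumes "m > 0"
  shows "f (x N) - f xopt
    \<le> L * R\<^sup>2 * exp (- (1 / 2) * sqrt (m / L) * real N) + (1 + sqrt (L / m)) * (\<delta>\<^sup>2 / L)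
      + 3 * radius N * \<delta>"
proof (rule linear_rate[OF assms])
  show "0 \<le> 3 * radius N * \<delta>"
    using radius_nonneg \<delta>_nonneg by simp
  show "0 \<le> \<delta>\<^sup>2 / L"
    using L_pos by simp
  then have "\<delta>\<^sup>2 / L * (\<Sum>k<N. A (Suc k)) \<le> \<delta>\<^sup>2 / L * (\<Sum>k\<le>N. A k)"
    unfolding sum.atMost_shift using A_pos[of 0] by (intro mult_left_mono) auto
  then show "A N * (f (x N) - f xopt)
      \<le> R\<^sup>2 / 2 + \<delta>\<^sup>2 / L * (\<Sum>k\<le>N. A k) + A N * (3 * radius N * \<delta>)"
    using radius_bound[of N] by linarith
qed

lemma rate_young:
  assumes "m > 0" "\<mu> > 0" "m \<le> \<mu> / 2"
  shows "f (x N) - f xopt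
    \<le> L * R\<^sup>2 * exp (- (1 / 2) * sqrt (m / L) * real N) + (1 + sqrt (L / m)) * (\<delta>\<^sup>2 / L)
      + (1 + sqrt (L / m)) * (\<delta>\<^sup>2 / \<mu>)"
  using linear_rate[of "\<delta>\<^sup>2 / L + \<delta>\<^sup>2 / \<mu>" 0 N] young_bound[of N] assms L_pos
  by (simp add: distrib_left)

text \<open>Each of the \<open>N\<close> weights in the error sum is bounded by \<open>A N\<close>,
  hence the factor \<open>N\<close> on \<open>\<delta>\<^sup>2 / L\<close>; the quadratic growth of
  \<open>A N\<close> gives the main term.\<close>

lemma rate_sublinear:
  assumes "N \<ge> 1"
  shows "f (x N) - f xopt \<le> 4 * L * R\<^sup>2 / (real N)\<^sup>2 + 3 * radius N * \<delta> + real N * (\<delta>\<^sup>2 / L)"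
proof -
  have "(real N)\<^sup>2 / (4 * L) \<le> (real N + 1)\<^sup>2 / (4 * L)"
    using L_pos by (intro divide_right_mono power_mono) auto
  then have lb: "(real N)\<^sup>2 / (4 * L) \<le> A N"
    using A_square_lower_bound[of N] by linarith
  have "(\<Sum>k<N. A (Suc k)) \<le> (\<Sum>k<N. A N)"
    by (intro sum_mono A_mono) auto
  then have "\<delta>\<^sup>2 / L * (\<Sum>k<N. A (Suc k)) \<le> \<delta>\<^sup>2 / L * (real N * A N)"
    using L_pos by (intro mult_left_mono) auto
  then have "A N * (f (x N) - f xopt)
      \<le> R\<^sup>2 / 2 + A N * (3 * radius N * \<delta> + real N * (\<delta>\<^sup>2 / L))"
    using radius_bound[of N] by (simp add: algebra_simps)
  then have "f (x N) - f xopt \<le> R\<^sup>2 / 2 / A N + (3 * radius N * \<delta> + real N * (\<delta>\<^sup>2 / L))"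
    using A_pos[of N] by (simp add: field_simps)
  also have "R\<^sup>2 / 2 / A N \<le> R\<^sup>2 / ((real N)\<^sup>2 / (4 * L))"
    using lb assms L_pos by (intro frac_le) auto
  finally show ?thesis
    by (simp add: mult_ac)
qed

end

theorem theorem4p7:
  fixes Q :: "(real ^ 'n) set"
    and f :: "real ^ 'n \<Rightarrow> real"
    and grad G :: "real ^ 'n \<Rightarrow> real ^ 'n"
    and xstart xopt :: "real ^ 'n"
    and Lf \<mu> \<delta> R L \<mu>1 \<mu>2 \<delta>1 \<delta>2 \<delta>3 :: real
  assumes "closed Q" and "convex Q"
    and "\<And>x. x \<in> Q \<Longrightarrow> (f has_derivative (\<lambda>h. grad x \<bullet> h)) (at x within Q)"
    and "Lf > 0" and "Lf-lipschitz_on Q grad"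
    and "\<mu> \<ge> 0" and "strongly_convex_on \<mu> Q f grad"
    and "\<And>x. x \<in> Q \<Longrightarrow> norm (G x - grad x) \<le> \<delta>"
    and "xstart \<in> Q"
    and "is_arg_min f (\<lambda>x. x \<in> Q) xopt"
    and "\<And>y. is_arg_min f (\<lambda>x. x \<in> Q) y \<Longrightarrow> norm (xopt - xstart) \<le> norm (y - xstart)"
    and "L = 2 * Lf"
    and "\<mu>1 = \<mu>" and "\<mu>2 = \<mu> / 2"
    and "\<delta>1 = \<delta>" and "\<delta>2 = \<delta>\<^sup>2 / L" and "\<mu> \<noteq> 0 \<Longrightarrow> \<delta>3 = \<delta>\<^sup>2 / \<mu>"
    and "norm (xstart - xopt) \<le> R"
  shows "(\<mu> \<noteq> 0 \<longrightarrow>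
      (\<forall>N::nat.
        f (stm_x (stm Q f G L \<mu>1 xstart N)) - f xopt
          \<le> L * R\<^sup>2 * exp (- (1 / 2) * sqrt (\<mu>1 / L) * real N)
            + (1 + sqrt (L / \<mu>1)) * \<delta>2
            + 3 * stm_radius (stm Q f G L \<mu>1 xstart) xopt N * \<delta>1) \<and>
      (\<forall>N::nat.
        f (stm_x (stm Q f G L \<mu>2 xstart N)) - f xopt
          \<le> L * R\<^sup>2 * exp (- (1 / 2) * sqrt (\<mu>2 / L) * real N)
            + (1 + sqrt (L / \<mu>2)) * \<delta>2
            + (1 + sqrt (L / \<mu>2)) * \<delta>3)) \<and>
    (\<mu> = 0 \<longrightarrow>
      (\<forall>N::nat. N \<ge> 1 \<longrightarrow>
        f (stm_x (stm Q f G L 0 xstart N)) - f xopt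
          \<le> 4 * L * R\<^sup>2 / (real N)\<^sup>2
            + 3 * stm_radius (stm Q f G L 0 xstart) xopt N * \<delta>1
            + real N * \<delta>2))"
proof -
  have "Lf > 0" "L > 0" "xopt \<in> Q"
    using assms(4,10,12) by (auto simp: is_arg_min_def)
  \<comment> \<open>\<open>m\<close> is left free in order to be instantiated with
    \<open>\<mu>1\<close>, \<open>\<mu>2\<close> and 0.\<close>
  have inst: "stm_inexact Q f G L m xstart grad Lf \<mu> \<delta> R xopt" if "0 \<le> m" "m \<le> \<mu>" for m
    by unfold_locales (use that assms \<open>L > 0\<close> \<open>xopt \<in> Q\<close> in auto)
  show ?thesis
  proof (intro conjI impI allI)
    fix N :: nat
    assume "\<mu> \<noteq> 0"
    then have "\<mu> > 0" using \<open>\<mu> \<ge> 0\<close> by simp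
    interpret stm_inexact Q f G L \<mu>1 xstart grad Lf \<mu> \<delta> R xopt
      by (rule inst) (use assms in auto)
    show "f (stm_x (stm Q f G L \<mu>1 xstart N)) - f xopt
        \<le> L * R\<^sup>2 * exp (- (1 / 2) * sqrt (\<mu>1 / L) * real N) + (1 + sqrt (L / \<mu>1)) * \<delta>2
          + 3 * stm_radius (stm Q f G L \<mu>1 xstart) xopt N * \<delta>1"
      using rate_radius[of N] \<open>\<mu> > 0\<close> assms(13,15,16) by simp
  next
    fix N :: nat
    assume "\<mu> \<noteq> 0"
    then have "\<mu> > 0" using \<open>\<mu> \<ge> 0\<close> by simp
    interpret stm_inexact Q f G L \<mu>2 xstart grad Lf \<mu> \<delta> R xopt
      by (rule inst) (use assms in auto)
    show "f (stm_x (stm Q f G L \<mu>2 xstart N)) - f xopt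
        \<le> L * R\<^sup>2 * exp (- (1 / 2) * sqrt (\<mu>2 / L) * real N) + (1 + sqrt (L / \<mu>2)) * \<delta>2
          + (1 + sqrt (L / \<mu>2)) * \<delta>3"
      using rate_young[of N] \<open>\<mu> > 0\<close> \<open>\<mu>2 = \<mu> / 2\<close> unfolding assms(16) assms(17)[OF \<open>\<mu> \<noteq> 0\<close>] by auto
  next
    fix N :: nat
    assume "\<mu> = 0" "N \<ge> 1"
    interpret stm_inexact Q f G L 0 xstart grad Lf \<mu> \<delta> R xopt
      by (rule inst) (use \<open>\<mu> = 0\<close> in auto)
    show "f (stm_x (stm Q f G L 0 xstart N)) - f xopt
        \<le> 4 * L * R\<^sup>2 / (real N)\<^sup>2 + 3 * stm_radius (stm Q f G L 0 xstart) xopt N * \<delta>1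
          + real N * \<delta>2"
      using rate_sublinear[OF \<open>N \<ge> 1\<close>] assms(15,16) by simp
  qed
qed

end
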